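(* Let $(X,d,\preceq)$ be an ordered metric space, $F:X^n\to X$ a mapping and $\ast\in\mathfrak B_n$. Let $E$ be an $\overline{\mathrm O}$-complete subspace of $X$ such that $F(X^n)\subseteq E$. Suppose that the following conditions hold: (i) $F$ has the monotone property; (ii) either $F$ is $\overline{\mathrm O}$-continuous or $(E,d,\preceq)$ has the ICU property; (iii) there exist $x^{(0)}_1,\dots,x^{(0)}_n\in X$ such that $x^{(0)}_i\preceq F(x^{(0)}_{i_1},x^{(0)}_{i_2},\dots,x^{(0)}_{i_n})$ for each $i\in I_n$; (iv) there exists $\varphi\in\Omega$ such that $$\frac1n\sum_{i=1}^n d\big(F(x_{i_1},\dots,x_{i_n}),F(y_{i_1},\dots,y_{i_n})\big)\le\varphi\Big(\frac1n\sum_{i=1}^n d(x_i,y_i)\Big)$$ for all $x_1,\dots,x_n,y_1,\dots,y_n\in X$ with [$x_i\preceq y_i$ for each $i\in I_n$] or [$x_i\succeq y_i$ for each $i\in I_n$]; or, alternatively to (iv), (iv$'$) there exists $\varphi\in\Omega$ such that $$\max_{i\in I_n} d\big(F(x_{i_1},\dots,x_{i_n}),F(y_{i_1},\dots,y_{i_n})\big)\le\varphi\Big(\max_{i\in I_n} d(x_i,y_i)\Big)$$ for all $x_1,\dots,x_n,y_1,\dots,y_n\in X$ with [$x_i\preceq y_i$ for each $i\in I_n$] or [$x_i\succeq y_i$ for each $i\in I_n$]. Then $F$ has an $\ast$-fixed point.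
   Context: Throughout, $n\ge 2$ is a fixed integer, $I_n=\{1,\dots,n\}$, and sequences are indexed by $m\in\mathbb N_0$. An ordered metric space $(X,d,\preceq)$ is a nonempty set $X$ with a metric $d$ and a partial order $\preceq$; $x\succeq y$ means $y\preceq x$. A subspace is a nonempty subset with the restricted metric and order. $\mathfrak B_n$ is the set of all binary operations $\ast:I_n\times I_n\to I_n$; for $\ast\in\mathfrak B_n$ write $i_k:=\ast(i,k)$. A sequence $\{x^{(m)}\}$ is increasing if $x^{(m)}\preceq x^{(m+1)}$ for all $m$. $x^{(m)}\uparrow x$ means that $\{x^{(m)}\}$ is increasing and converges to $x$ in $d$. $E$ is $\overline{\mathrm O}$-complete if every increasing Cauchy sequence in $E$ converges in $E$. $F$ is $\overline{\mathrm O}$-continuous if for every $(x_1,\dots,x_n)\in X^n$ and all sequences $\{x_1^{(m)}\},\dots,\{x_n^{(m)}\}$ in $X$ with $x_i^{(m)}\uparrow x_i$ for each $i$, one has $F(x_1^{(m)},\dots,x_n^{(m)})\to F(x_1,\dots,x_n)$. $(E,d,\preceq)$ has the ICU property if for every sequence $\{x^{(m)}\}$ in $E$ and $x\in E$ with $x^{(m)}\uparrow x$, one has $x^{(m)}\preceq x$ for all $m$. $F$ has the monotone property if, for all $x_1,\dots,x_n,y_1,\dots,y_n\in X$, $x_i\preceq y_i$ for all $i\in I_n$ implies $F(x_1,\dots,x_n)\preceq F(y_1,\dots,y_n)$. $\Omega$ is the set of functions $\varphi:[0,\infty)\to[0,\infty)$ with $\varphi(t)<t$ and $\limsup_{r\to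 t^+}\varphi(r)<t$ for each $t>0$. $(x_1,\dots,x_n)\in X^n$ is an $\ast$-fixed point of $F$ if $F(x_{i_1},\dots,x_{i_n})=x_i$ for each $i\in I_n$. *)

theory Defs
  imports "HOL-Analysis.Analysis"
begin

text \<open>
  An ordered metric space \<open>(X, d, \<preceq>)\<close> is a type of sort \<open>{metric_space, order}\<close>; the metric and the
  order are not assumed to be related. The index set \<open>I\<^sub>n = {1, \<dots>, n}\<close> is a finite index type \<open>'n\<close>
  with \<open>n = CARD('n)\<close>, and \<open>X\<^sup>n\<close> is \<open>'a ^ 'n\<close>, of which only the components are used (not its
  library order or metric). A binary operation on \<open>I\<^sub>n\<close> is a function \<open>'n \<Rightarrow> 'n \<Rightarrow> 'n\<close>.
\<close>

definition increasing_seq :: "(nat \<Rightarrow> 'a::order) \<Rightarrow> bool" where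
  "increasing_seq x \<longleftrightarrow> (\<forall>m. x m \<le> x (Suc m))"

definition up_converges :: "(nat \<Rightarrow> 'a::{metric_space, order}) \<Rightarrow> 'a \<Rightarrow> bool" where
  "up_converges x l \<longleftrightarrow> increasing_seq x \<and> x \<longlonglongrightarrow> l"

definition O_complete :: "'a::{metric_space, order} set \<Rightarrow> bool" where
  "O_complete E \<longleftrightarrow>
     (\<forall>x. range x \<subseteq> E \<and> increasing_seq x \<and> Cauchy x \<longrightarrow> (\<exists>l\<in>E. x \<longlonglongrightarrow> l))"

definition O_continuous :: "('a::{metric_space, order} ^ 'n \<Rightarrow> 'a) \<Rightarrow> bool" where
  "O_continuous F \<longleftrightarrow>
     (\<forall>(x :: 'a ^ 'n) (s :: 'n \<Rightarrow> nat \<Rightarrow> 'a). (\<forall>i. up_converges (s i) (x $ i)) \<longrightarrow>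
        (\<lambda>m. F (\<chi> i. s i m)) \<longlonglongrightarrow> F x)"

definition ICU_property :: "'a::{metric_space, order} set \<Rightarrow> bool" where
  "ICU_property E \<longleftrightarrow>
     (\<forall>x l. range x \<subseteq> E \<and> l \<in> E \<and> up_converges x l \<longrightarrow> (\<forall>m. x m \<le> l))"

definition monotone_property :: "('a::order ^ 'n \<Rightarrow> 'a) \<Rightarrow> bool" where
  "monotone_property F \<longleftrightarrow> (\<forall>x y. (\<forall>i. x $ i \<le> y $ i) \<longrightarrow> F x \<le> F y)"

text \<open>
  Functions \<open>[0,\<infinity>) \<rightarrow> [0,\<infinity>)\<close> are represented by total functions on the reals whose values at
  negative arguments are irrelevant. The upper limit is taken in the extended reals, since the
  conditionally complete type \<open>real\<close> has no \<open>Limsup\<close>. No condition is imposed on \<open>\<phi> 0\<close> beyond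
  nonnegativity.
\<close>

definition Omega_class :: "(real \<Rightarrow> real) set" where
  "Omega_class = {\<phi>. (\<forall>t\<ge>0. 0 \<le> \<phi> t) \<and>
     (\<forall>t>0. \<phi> t < t \<and> Limsup (at_right t) (\<lambda>r. ereal (\<phi> r)) < ereal t)}"

text \<open>\<open>star_tuple op x i\<close> is the tuple \<open>(x\<^bsub>i\<^sub>1\<^esub>, \<dots>, x\<^bsub>i\<^sub>n\<^esub>)\<close>, where \<open>i\<^sub>k\<close> is \<open>op i k\<close>.\<close>

definition star_tuple :: "('n \<Rightarrow> 'n \<Rightarrow> 'n) \<Rightarrow> 'a ^ 'n \<Rightarrow> 'n \<Rightarrow> 'a ^ 'n" where
  "star_tuple op x i = (\<chi> k. x $ op i k)"

definition star_fixed_point :: "('n \<Rightarrow> 'n \<Rightarrow> 'n) \<Rightarrow> ('a ^ 'n \<Rightarrow> 'a) \<Rightarrow> 'a ^ 'n \<Rightarrow> bool" where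
  "star_fixed_point op F x \<longleftrightarrow> (\<forall>i. F (star_tuple op x i) = x $ i)"

end

theory Submission
  imports Defs
begin

text \<open>
  The tuple map \<open>T x = (F (x\<^bsub>i\<^sub>1\<^esub>, \<dots>, x\<^bsub>i\<^sub>n\<^esub>))\<^sub>i\<close> turns \<open>\<ast>\<close>-fixed points of \<open>F\<close> into ordinary fixed
  points, and for the componentwise order it is monotone with \<open>x0 \<le> T x0\<close>. Both contraction
  conditions bound \<open>D (T x) (T y)\<close> by \<open>\<phi> (D x y)\<close> for comparable tuples, where \<open>D\<close> is the mean or
  the maximum of the coordinate distances. All that matters about \<open>D\<close> is that it satisfies the
  triangle inequality, dominates each coordinate distance up to a constant factor and is at most
  their sum, so one argument (locale \<open>tuple_gauge\<close>) covers both.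

  The class \<open>\<Omega>\<close> enters through a single consequence (\<open>Omega_class_gap\<close>): for every \<open>\<epsilon> > 0\<close>,
  \<open>\<phi>\<close> stays below \<open>\<epsilon>\<close> on some interval \<open>[\<epsilon>, \<epsilon> + \<delta>)\<close>. This makes \<open>T\<close> a Meir--Keeler map on
  ordered pairs. The iterates \<open>T\<^sup>m x0\<close> increase, their consecutive gaps decrease to \<open>0\<close>
  (\<open>gaps_tend_to_0\<close>), and the Meir--Keeler condition then traps all later iterates near a given
  one (\<open>orbit_stays_close\<close>); hence every coordinate of the orbit is an increasing Cauchy sequence,
  in \<open>E\<close> from the first iterate on, and converges in \<open>E\<close> (\<open>orbit_converges\<close>).

  The limit \<open>l\<close> is fixed by \<open>T\<close> because \<open>T\<^sup>m\<^sup>+\<^sup>1 x0\<close> converges to \<open>T l\<close> as well: either directly by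
  continuity of \<open>F\<close> along increasing sequences, or because the ICU property makes \<open>T\<^sup>m x0 \<le> l\<close>, so
  that \<open>D (T\<^sup>m\<^sup>+\<^sup>1 x0) (T l) \<le> D (T\<^sup>m x0) l\<close>, which tends to \<open>0\<close>.
\<close>

section \<open>The gap property of comparison functions\<close>

text \<open>
  The upper limit controls \<open>\<phi>\<close> on an open interval to the right of \<open>t\<close>, and \<open>\<phi> t < t\<close> supplies the
  left endpoint, which is needed because a sequence decreasing to \<open>t\<close> may reach it.
\<close>
lemma Omega_class_gap:
  assumes "\<phi> \<in> Omega_class" "0 < t"
  shows "\<exists>\<delta>>0. \<forall>r. t \<le> r \<and> r < t + \<delta> \<longrightarrow> \<phi> r < t"
proof -
  have here: "\<phi> t < t" and lim: "Limsup (at_right t) (\<lambda>r. ereal (\<phi> r)) < ereal t"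
    using assms by (auto simp: Omega_class_def)
  have "eventually (\<lambda>r. \<phi> r < t) (at_right t)"
    using Limsup_lessD[OF lim] by simp
  then obtain b where "b > t" "\<And>r. t < r \<Longrightarrow> r < b \<Longrightarrow> \<phi> r < t"
    by (auto simp: eventually_at_right_field)
  then show ?thesis
    using here by (intro exI[of _ "b - t"]) (auto simp: le_less)
qed

section \<open>The tuple map\<close>

definition tuple_map :: "('n \<Rightarrow> 'n \<Rightarrow> 'n) \<Rightarrow> ('a ^ 'n \<Rightarrow> 'a) \<Rightarrow> 'a ^ 'n \<Rightarrow> 'a ^ 'n::finite" where
  "tuple_map op F x = (\<chi> i. F (star_tuple op x i))"

lemma tuple_map_nth [simp]: "tuple_map op F x $ i = F (star_tuple op x i)"
  by (simp add: tuple_map_def)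

lemma star_fixed_point_iff: "star_fixed_point op F x \<longleftrightarrow> tuple_map op F x = x"
  by (auto simp: star_fixed_point_def vec_eq_iff)

lemma mono_tuple_map:
  assumes "monotone_property F"
  shows "mono (tuple_map op F)"
  using assms by (auto intro!: monoI simp: less_eq_vec_def monotone_property_def star_tuple_def)

lemma O_continuousD:
  assumes "O_continuous F" "\<And>i. up_converges (s i) (x $ i)"
  shows "(\<lambda>m. F (\<chi> i. s i m)) \<longlonglongrightarrow> F x"
  using assms unfolding O_continuous_def by simp

lemma O_completeD:
  assumes "O_complete E" "\<And>m. s m \<in> E" "increasing_seq s" "Cauchy s"
  shows "\<exists>l\<in>E. s \<longlonglongrightarrow> l"
  using assms unfolding O_complete_def by (simp add: image_subset_iff)

lemma ICU_propertyD:
  assumes "ICU_property E" "\<And>m. s m \<in> E" "l \<in> E" "up_converges s l"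
  shows "s m \<le> l"
  using assms unfolding ICU_property_def by (simp add: image_subset_iff)

section \<open>Meir--Keeler maps on tuples\<close>

text \<open>
  Common ground of the mean (with \<open>C = n\<close>) and the maximum (with \<open>C = 1\<close>) of the coordinate
  distances. The lower bound \<open>coord_le\<close> lets a Cauchy estimate for \<open>D\<close> descend to the coordinates,
  the upper bound \<open>le_sum\<close> turns coordinatewise convergence into convergence for \<open>D\<close>.
\<close>
locale tuple_gauge =
  fixes D :: "'a::{metric_space, order} ^ 'n::finite \<Rightarrow> 'a ^ 'n \<Rightarrow> real" and C :: real
  assumes C_pos: "0 < C"
    and coord_le: "\<And>x y i. dist (x $ i) (y $ i) \<le> C * D x y"
    and le_sum: "\<And>x y. D x y \<le> (\<Sum>i\<in>UNIV. dist (x $ i) (y $ i))"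
    and triangle: "\<And>x y z. D x z \<le> D x y + D y z"
begin

lemma nonneg: "0 \<le> D x y"
proof -
  have "0 \<le> C * D x y"
    by (rule order_trans[OF zero_le_dist coord_le])
  with C_pos show ?thesis by (simp add: zero_le_mult_iff)
qed

lemma self_eq_0: "D x x = 0"
  using le_sum[of x x] nonneg[of x x] by simp

lemma eq_if_eq_0:
  assumes "D x y = 0"
  shows "x = y"
  using coord_le[of x _ y] assms by (simp add: vec_eq_iff)

definition meir_keeler :: "('a ^ 'n \<Rightarrow> 'a ^ 'n) \<Rightarrow> bool" where
  "meir_keeler T \<longleftrightarrow>
     (\<forall>\<epsilon>>0. \<exists>\<delta>>0. \<forall>x y. x \<le> y \<and> \<epsilon> \<le> D x y \<and> D x y < \<epsilon> + \<delta> \<longrightarrow> D (T x) (T y) < \<epsilon>)"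

lemma meir_keelerE:
  assumes "meir_keeler T" "0 < \<epsilon>"
  obtains \<delta> where "0 < \<delta>"
    and "\<And>x y. x \<le> y \<Longrightarrow> \<epsilon> \<le> D x y \<Longrightarrow> D x y < \<epsilon> + \<delta> \<Longrightarrow> D (T x) (T y) < \<epsilon>"
proof -
  obtain \<delta> where "0 < \<delta>"
    and close: "\<forall>x y. x \<le> y \<and> \<epsilon> \<le> D x y \<and> D x y < \<epsilon> + \<delta> \<longrightarrow> D (T x) (T y) < \<epsilon>"
    using assms by (auto simp: meir_keeler_def)
  then show thesis
    by (intro that[of \<delta>] close[rule_format] conjI)
qed

lemma meir_keeler_if_Omega_contraction:
  assumes "\<phi> \<in> Omega_class" "\<And>x y. x \<le> y \<Longrightarrow> D (T x) (T y) \<le> \<phi> (D x y)"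
  shows "meir_keeler T"
  unfolding meir_keeler_def
proof (intro allI impI)
  fix \<epsilon> :: real assume "0 < \<epsilon>"
  then obtain \<delta> where "0 < \<delta>" "\<And>r. \<epsilon> \<le> r \<Longrightarrow> r < \<epsilon> + \<delta> \<Longrightarrow> \<phi> r < \<epsilon>"
    using Omega_class_gap[OF assms(1)] by blast
  then show "\<exists>\<delta>>0. \<forall>x y. x \<le> y \<and> \<epsilon> \<le> D x y \<and> D x y < \<epsilon> + \<delta> \<longrightarrow> D (T x) (T y) < \<epsilon>"
    by (intro exI[of _ \<delta>]) (auto intro: le_less_trans[OF assms(2)])
qed

lemma meir_keeler_nonexpansive:
  assumes "meir_keeler T" "x \<le> y"
  shows "D (T x) (T y) \<le> D x y"
proof (cases "D x y = 0")
  \<comment> \<open>At distance \<open>0\<close> the condition says nothing, but then the tuples coincide.\<close>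
  case True
  then have "x = y" by (rule eq_if_eq_0)
  then show ?thesis by (simp add: self_eq_0)
next
  case False
  then have "0 < D x y" using nonneg[of x y] by simp
  with assms(1) obtain \<delta> where "0 < \<delta>"
    and "\<And>x' y'. x' \<le> y' \<Longrightarrow> D x y \<le> D x' y' \<Longrightarrow> D x' y' < D x y + \<delta> \<Longrightarrow> D (T x') (T y') < D x y"
    using meir_keelerE by metis
  from this(2)[OF assms(2)] this(1) show ?thesis by simp
qed

text \<open>
  The gaps are nonincreasing, hence converge to some \<open>a \<ge> 0\<close> from above. If \<open>a\<close> were positive, a gap
  close enough to \<open>a\<close> would be followed by one below \<open>a\<close>.
\<close>
lemma gaps_tend_to_0:
  assumes mk: "meir_keeler T" and inc: "\<And>m. s m \<le> s (Suc m)" and step: "\<And>m. s (Suc m) = T (s m)"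
  shows "(\<lambda>m. D (s m) (s (Suc m))) \<longlonglongrightarrow> 0"
proof -
  let ?g = "\<lambda>m. D (s m) (s (Suc m))"
  have "?g (Suc m) \<le> ?g m" for m
    using meir_keeler_nonexpansive[OF mk inc[of m]] by (simp add: step)
  then have "decseq ?g" by (intro decseq_SucI)
  then obtain a where lim: "?g \<longlonglongrightarrow> a" and lower: "\<And>m. a \<le> ?g m"
    using decseq_convergent[of ?g 0] nonneg by blast
  have "a \<le> 0"
  proof (rule ccontr)
    assume "\<not> a \<le> 0"
    then have "0 < a" by simp
    with mk obtain \<delta> where "\<delta> > 0"
      and below: "\<And>x y. x \<le> y \<Longrightarrow> a \<le> D x y \<Longrightarrow> D x y < a + \<delta> \<Longrightarrow> D (T x) (T y) < a"
      using meir_keelerE by metis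
    then have "eventually (\<lambda>m. ?g m < a + \<delta>) sequentially"
      using order_tendstoD(2)[OF lim] by simp
    then obtain m where "?g m < a + \<delta>"
      by (auto simp: eventually_sequentially)
    then have "?g (Suc m) < a"
      using below[OF inc[of m] lower[of m]] by (simp add: step)
    then show False using lower[of "Suc m"] by simp
  qed
  moreover have "0 \<le> a" using LIMSEQ_le_const[OF lim] nonneg by blast
  ultimately show ?thesis using lim by simp
qed

text \<open>
  Once a gap is below \<open>\<delta>\<close>, the ball of radius \<open>\<epsilon> + \<delta>\<close> about \<open>s m\<close> cannot be left: applying \<open>T\<close> to
  the pair \<open>(s m, s (m + k))\<close> brings its distance below \<open>\<epsilon>\<close>, and returning from \<open>s (m + 1)\<close> to \<open>s m\<close>
  costs less than \<open>\<delta>\<close>.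
\<close>
lemma orbit_stays_close:
  assumes mk: "meir_keeler T" and inc: "mono s" and step: "\<And>m. s (Suc m) = T (s m)"
    and "0 < \<epsilon>" and "0 < \<delta>"
    and below: "\<And>x y. x \<le> y \<Longrightarrow> \<epsilon> \<le> D x y \<Longrightarrow> D x y < \<epsilon> + \<delta> \<Longrightarrow> D (T x) (T y) < \<epsilon>"
    and gap: "D (s m) (s (Suc m)) < \<delta>"
  shows "D (s m) (s (m + k)) < \<epsilon> + \<delta>"
proof (induction k)
  case 0
  show ?case using \<open>0 < \<epsilon>\<close> \<open>0 < \<delta>\<close> by (simp add: self_eq_0)
next
  case (Suc k)
  have le: "s m \<le> s (m + k)" using inc by (simp add: monoD)
  have "D (T (s m)) (T (s (m + k))) < \<epsilon>"
    using below[OF le _ Suc] meir_keeler_nonexpansive[OF mk le] by linarith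
  then show ?case
    using triangle[of "s m" "s (m + Suc k)" "s (Suc m)"] gap by (simp add: step)
qed

lemma orbit_Cauchy:
  assumes mk: "meir_keeler T" and inc: "mono s" and step: "\<And>m. s (Suc m) = T (s m)"
  shows "Cauchy (\<lambda>m. s m $ i)"
  unfolding Cauchy_altdef
proof (intro allI impI)
  fix e :: real assume "e > 0"
  define \<epsilon> where "\<epsilon> = e / (2 * C)"
  have "\<epsilon> > 0" using \<open>e > 0\<close> C_pos by (simp add: \<epsilon>_def)
  with mk obtain \<delta>' where "\<delta>' > 0"
    and below': "\<And>x y. x \<le> y \<Longrightarrow> \<epsilon> \<le> D x y \<Longrightarrow> D x y < \<epsilon> + \<delta>' \<Longrightarrow> D (T x) (T y) < \<epsilon>"
    using meir_keelerE by metis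
  \<comment> \<open>A smaller \<open>\<delta>\<close> serves as well; with \<open>\<delta> \<le> \<epsilon>\<close> the orbit stays within \<open>2 * \<epsilon>\<close>.\<close>
  define \<delta> where "\<delta> = min \<delta>' \<epsilon>"
  have "\<delta> > 0" "\<delta> \<le> \<epsilon>" using \<open>\<delta>' > 0\<close> \<open>\<epsilon> > 0\<close> by (auto simp: \<delta>_def)
  have below: "\<And>x y. x \<le> y \<Longrightarrow> \<epsilon> \<le> D x y \<Longrightarrow> D x y < \<epsilon> + \<delta> \<Longrightarrow> D (T x) (T y) < \<epsilon>"
    using below' by (simp add: \<delta>_def)
  have "(\<lambda>m. D (s m) (s (Suc m))) \<longlonglongrightarrow> 0"
    using mk inc step by (intro gaps_tend_to_0) (auto simp: mono_iff_le_Suc)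
  then have "eventually (\<lambda>m. D (s m) (s (Suc m)) < \<delta>) sequentially"
    using order_tendstoD(2) \<open>\<delta> > 0\<close> by blast
  then obtain M where M: "\<And>m. m \<ge> M \<Longrightarrow> D (s m) (s (Suc m)) < \<delta>"
    by (auto simp: eventually_sequentially)
  have "dist (s m $ i) (s n $ i) < e" if "M \<le> m" "m < n" for m n
  proof -
    obtain k where n: "n = m + k" using \<open>m < n\<close> less_imp_add_positive by blast
    have "D (s m) (s n) < 2 * \<epsilon>"
      using orbit_stays_close[OF mk inc step \<open>\<epsilon> > 0\<close> \<open>\<delta> > 0\<close> below M[OF \<open>M \<le> m\<close>], of k] \<open>\<delta> \<le> \<epsilon>\<close>
      by (simp add: n)
    then have "C * D (s m) (s n) < C * (2 * \<epsilon>)" using C_pos by simp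
    also have "\<dots> = e" using C_pos by (simp add: \<epsilon>_def)
    finally show ?thesis using coord_le[of "s m" i "s n"] by linarith
  qed
  then show "\<exists>M. \<forall>m\<ge>M. \<forall>n>m. dist (s m $ i) (s n $ i) < e" by blast
qed

text \<open>
  The starting tuple need not have its coordinates in \<open>E\<close>, so completeness is applied to the orbit
  shifted by one.
\<close>
lemma orbit_converges:
  assumes mk: "meir_keeler T" and inc: "mono s" and step: "\<And>m. s (Suc m) = T (s m)"
    and E: "O_complete E" "\<And>x i. T x $ i \<in> E"
  obtains l where "\<And>i. l $ i \<in> E" "\<And>i. up_converges (\<lambda>m. s m $ i) (l $ i)"
proof -
  have inc_coord: "increasing_seq (\<lambda>m. s m $ i)" for i
    using inc by (auto simp: increasing_seq_def mono_iff_le_Suc less_eq_vec_def)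
  have "\<exists>l\<in>E. (\<lambda>m. s (Suc m) $ i) \<longlonglongrightarrow> l" for i
  proof -
    have "s (Suc m) $ i \<in> E" for m using E(2) by (simp add: step)
    moreover have "Cauchy ((\<lambda>m. s m $ i) \<circ> Suc)"
      by (rule Cauchy_subseq_Cauchy[OF orbit_Cauchy[where s = s, OF mk inc step]])
        (simp add: strict_mono_def)
    ultimately show ?thesis
      using inc_coord[of i]
      by (intro O_completeD[OF E(1), where s = "\<lambda>m. s (Suc m) $ i"]) (simp_all add: o_def increasing_seq_def)
  qed
  then obtain l where "\<And>i. l i \<in> E" "\<And>i. (\<lambda>m. s (Suc m) $ i) \<longlonglongrightarrow> l i" by metis
  moreover from this have "(\<lambda>m. s m $ i) \<longlonglongrightarrow> l i" for i
    using filterlim_sequentially_Suc[of "\<lambda>m. s m $ i"] by blast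
  ultimately show ?thesis
    using inc_coord by (intro that[of "\<chi> i. l i"]) (simp_all add: up_converges_def)
qed

text \<open>
  For a point above the whole orbit, nonexpansiveness on ordered pairs replaces continuity of \<open>T\<close>.
\<close>
lemma image_converges_if_upper_bound:
  assumes mk: "meir_keeler T" and upper: "\<And>m. s m \<le> l"
    and lim: "\<And>i. (\<lambda>m. s m $ i) \<longlonglongrightarrow> l $ i"
  shows "(\<lambda>m. T (s m) $ i) \<longlonglongrightarrow> T l $ i"
proof -
  have "(\<lambda>m. dist (s m $ j) (l $ j)) \<longlonglongrightarrow> 0" for j
    by (rule tendsto_dist_iff[THEN iffD1, OF lim])
  then have sum_lim: "(\<lambda>m. C * (\<Sum>j\<in>UNIV. dist (s m $ j) (l $ j))) \<longlonglongrightarrow> 0"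
    by (intro tendsto_mult_right_zero tendsto_null_sum)
  have bound: "dist (T (s m) $ i) (T l $ i) \<le> C * (\<Sum>j\<in>UNIV. dist (s m $ j) (l $ j))" for m
  proof -
    have "D (T (s m)) (T l) \<le> (\<Sum>j\<in>UNIV. dist (s m $ j) (l $ j))"
      by (rule order_trans[OF meir_keeler_nonexpansive[OF mk upper] le_sum])
    then have "C * D (T (s m)) (T l) \<le> C * (\<Sum>j\<in>UNIV. dist (s m $ j) (l $ j))"
      using C_pos by simp
    then show ?thesis by (rule order_trans[OF coord_le])
  qed
  have "(\<lambda>m. dist (T (s m) $ i) (T l $ i)) \<longlonglongrightarrow> 0"
    by (rule Lim_null_comparison[OF _ sum_lim]) (simp add: bound)
  then show ?thesis by (rule tendsto_dist_iff[THEN iffD2])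
qed

lemma star_fixed_point_exists:
  assumes mk: "meir_keeler (tuple_map op F)" and mono: "monotone_property F"
    and E: "O_complete E" "range F \<subseteq> E" "O_continuous F \<or> ICU_property E"
    and start: "x0 \<le> tuple_map op F x0"
  shows "\<exists>x. star_fixed_point op F x"
proof -
  let ?T = "tuple_map op F"
  define s where "s m = (?T ^^ m) x0" for m
  have step: "s (Suc m) = ?T (s m)" for m by (simp add: s_def)
  have "s m \<le> s (Suc m)" for m
  proof (induction m)
    case 0
    show ?case using start by (simp add: s_def)
  next
    case (Suc m)
    then show ?case unfolding step using monoD[OF mono_tuple_map[OF mono]] by blast
  qed
  then have inc: "mono s" by (simp add: mono_iff_le_Suc)
  have in_E: "?T x $ i \<in> E" for x i using E(2) by auto
  obtain l where l: "\<And>i. l $ i \<in> E" "\<And>i. up_converges (\<lambda>m. s m $ i) (l $ i)"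
    using orbit_converges[where s = s, OF mk inc step E(1) in_E] by metis
  then have lim: "(\<lambda>m. s m $ i) \<longlonglongrightarrow> l $ i" for i by (simp add: up_converges_def)
  have "(\<lambda>m. ?T (s m) $ i) \<longlonglongrightarrow> ?T l $ i" for i
    using E(3)
  proof
    assume cont: "O_continuous F"
    have "(\<lambda>m. F (\<chi> k. s m $ op i k)) \<longlonglongrightarrow> F (star_tuple op l i)"
      using l(2)
      by (intro O_continuousD[OF cont, where s = "\<lambda>k m. s m $ op i k"]) (simp add: star_tuple_def)
    then show ?thesis by (simp add: star_tuple_def[of op "s _"])
  next
    assume icu: "ICU_property E"
    have above: "s (Suc m) \<le> l" for m
    proof -
      have "up_converges (\<lambda>m. s (Suc m) $ j) (l $ j)" for j
        using l(2)[of j] unfolding up_converges_def increasing_seq_def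
        by (auto simp: filterlim_sequentially_Suc[of "\<lambda>m. s m $ j"])
      moreover have "s (Suc m) $ j \<in> E" for m j unfolding step by (rule in_E)
      ultimately have "s (Suc m) $ j \<le> l $ j" for j
        using ICU_propertyD[OF icu, where s = "\<lambda>m. s (Suc m) $ j"] l(1) by simp
      then show ?thesis by (simp add: less_eq_vec_def)
    qed
    \<comment> \<open>The starting tuple, possibly outside \<open>E\<close>, lies below the first iterate.\<close>
    then have "s m \<le> l" for m
      using inc by (meson lessI less_imp_le monoD order_trans)
    then show ?thesis by (rule image_converges_if_upper_bound[OF mk _ lim])
  qed
  moreover have "(\<lambda>m. ?T (s m) $ i) \<longlonglongrightarrow> l $ i" for i
    using lim[of i] by (simp add: step[symmetric] filterlim_sequentially_Suc[of "\<lambda>m. s m $ i"] del: tuple_map_nth)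
  ultimately have "?T l = l" unfolding vec_eq_iff by (blast intro: LIMSEQ_unique)
  then show ?thesis by (auto simp: star_fixed_point_iff)
qed

end

section \<open>Mean and maximum of the coordinate distances\<close>

lemma tuple_gauge_mean:
  "tuple_gauge (\<lambda>x y :: 'a::{metric_space, order} ^ 'n::finite.
     1 / real CARD('n) * (\<Sum>i\<in>UNIV. dist (x $ i) (y $ i))) (real CARD('n))"
proof (unfold_locales, goal_cases)
  case 1
  then show ?case by simp
next
  case (2 x y i)
  have "dist (x $ i) (y $ i) \<le> (\<Sum>i\<in>UNIV. dist (x $ i) (y $ i))"
    by (rule member_le_sum) auto
  then show ?case by simp
next
  case (3 x y)
  have "1 / real CARD('n) \<le> 1" by (simp add: Suc_leI)
  then show ?case by (intro mult_left_le_one_le sum_nonneg) simp_all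
next
  case (4 x y z)
  have "(\<Sum>i\<in>UNIV. dist (x $ i) (z $ i))
      \<le> (\<Sum>i\<in>UNIV. dist (x $ i) (y $ i)) + (\<Sum>i\<in>UNIV. dist (y $ i) (z $ i))"
    unfolding sum.distrib[symmetric] by (intro sum_mono dist_triangle)
  then show ?case
    unfolding distrib_left[symmetric] by (rule mult_left_mono) simp
qed

lemma tuple_gauge_Max:
  "tuple_gauge (\<lambda>x y :: 'a::{metric_space, order} ^ 'n::finite.
     MAX i\<in>UNIV. dist (x $ i) (y $ i)) 1"
proof (unfold_locales, goal_cases)
  case 1
  then show ?case by simp
next
  case (2 x y i)
  then show ?case by simp
next
  case (3 x y)
  have "dist (x $ i) (y $ i) \<le> (\<Sum>i\<in>UNIV. dist (x $ i) (y $ i))" for i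
    by (rule member_le_sum) auto
  then show ?case by simp
next
  case (4 x y z)
  have "dist (x $ i) (z $ i)
      \<le> (MAX i\<in>UNIV. dist (x $ i) (y $ i)) + (MAX i\<in>UNIV. dist (y $ i) (z $ i))" for i
    by (rule order_trans[OF dist_triangle[of _ _ "y $ i"]], rule add_mono) simp_all
  then show ?case by simp
qed

theorem theorem12:
  fixes F :: "'a::{metric_space, order} ^ 'n::finite \<Rightarrow> 'a"
    and op :: "'n \<Rightarrow> 'n \<Rightarrow> 'n"
    and E :: "'a set"
  assumes "CARD('n) \<ge> 2"
    and "E \<noteq> {}"
    and "O_complete E"
    and "range F \<subseteq> E"
    and "monotone_property F"
    and "O_continuous F \<or> ICU_property E"
    and "\<exists>x0 :: 'a ^ 'n. \<forall>i. x0 $ i \<le> F (star_tuple op x0 i)"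
    and "(\<exists>\<phi>\<in>Omega_class. \<forall>x y :: 'a ^ 'n.
            (\<forall>i. x $ i \<le> y $ i) \<or> (\<forall>i. x $ i \<ge> y $ i) \<longrightarrow>
            1 / real CARD('n) * (\<Sum>i\<in>UNIV. dist (F (star_tuple op x i)) (F (star_tuple op y i)))
              \<le> \<phi> (1 / real CARD('n) * (\<Sum>i\<in>UNIV. dist (x $ i) (y $ i))))
       \<or> (\<exists>\<phi>\<in>Omega_class. \<forall>x y :: 'a ^ 'n.
            (\<forall>i. x $ i \<le> y $ i) \<or> (\<forall>i. x $ i \<ge> y $ i) \<longrightarrow>
            (MAX i\<in>UNIV. dist (F (star_tuple op x i)) (F (star_tuple op y i)))
              \<le> \<phi> (MAX i\<in>UNIV. dist (x $ i) (y $ i)))"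
  shows "\<exists>x. star_fixed_point op F x"
proof -
  obtain x0 where start: "x0 \<le> tuple_map op F x0"
    using assms(7) by (auto simp: less_eq_vec_def)
  have conclude: "\<exists>x. star_fixed_point op F x"
    if "tuple_gauge D C" "\<phi> \<in> Omega_class"
      "\<And>x y. x \<le> y \<Longrightarrow> D (tuple_map op F x) (tuple_map op F y) \<le> \<phi> (D x y)" for D C \<phi>
  proof -
    interpret tuple_gauge D C by fact
    show ?thesis
      by (rule star_fixed_point_exists[OF meir_keeler_if_Omega_contraction assms(5,3,4,6) start])
        (fact that)+
  qed
  from assms(8) show ?thesis
  proof (elim disjE bexE, goal_cases)
    case (1 \<phi>)
    show ?case
      by (rule conclude[OF tuple_gauge_mean 1(1)], unfold tuple_map_nth,
          rule 1(2)[rule_format], simp add: less_eq_vec_def)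
  next
    case (2 \<phi>)
    show ?case
      by (rule conclude[OF tuple_gauge_Max 2(1)], unfold tuple_map_nth,
          rule 2(2)[rule_format], simp add: less_eq_vec_def)
  qed
qed

end
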